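(* Let $\mathbf{X},\mathbf{Y},\mathbf{Z}$ be finite nonempty sets and let $P$ be a positive probability measure on $\mathbf{X}\times\mathbf{Y}\times\mathbf{Z}$ (every element has positive probability), with $(X,Y,Z)$ denoting random variables with joint distribution $P$. Fix $x\in\mathbf{X}$ and an integer $N\ge 1$, and let $(X_n,Y_n,Z_n)$, $n\in[N]$, be an IID sample from $P$. For $y\in\mathbf{Y}$ let $$p_y:=\sum_{z\in\mathbf{Z}}P(Z=z)\,P(Y=y\mid X=x,Z=z)$$ and $$F_y:=\sum_{z\in\mathbf{Z}}\frac{|\{n\in[N]:Z_n=z\}|+1}{N+1}\times\frac{|\{n\in[N]:(X_n,Y_n,Z_n)=(x,y,z)\}|+1}{|\{n\in[N]:(X_n,Z_n)=(x,z)\}|+1}.$$ Let $Y_{N+1}$ be a $\mathbf{Y}$-valued random variable, independent of the sample $(X_n,Y_n,Z_n)$, $n\in[N]$, taking each value $y\in\mathbf{Y}$ with probability $p_y$. Then for each probability measure $Q$ on $\mathbf{Y}$, the random variable $$E:=\frac{Q(\{Y_{N+1}\})}{F_{Y_{N+1}}}$$ is an e-variable, i.e., $E$ is nonnegative and $\mathbb{E}[E]\le 1$.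
   Context: For a positive integer $N$, $[N]:=\{1,\dots,N\}$. Finite sets carry the discrete $\sigma$-algebra, and $|A|$ denotes the cardinality of a finite set $A$. An e-variable is a nonnegative random variable with expectation at most 1. $F_{Y_{N+1}}$ denotes $F_y$ (a function of the sample) evaluated at $y=Y_{N+1}$, and $Q(\{Y_{N+1}\})$ denotes $Q(\{y\})$ evaluated at $y=Y_{N+1}$; the expectation is over both the sample and $Y_{N+1}$. *)

theory Defs
  imports "HOL-Probability.Probability"
begin

(* Integrability is demanded because the Bochner integral of a non-integrable function is 0. *)
definition e_variable :: "'w measure \<Rightarrow> ('w \<Rightarrow> real) \<Rightarrow> bool" where
  "e_variable M E \<longleftrightarrow>
     integrable M E \<and> (\<forall>\<omega>\<in>space M. 0 \<le> E \<omega>) \<and> (\<integral>\<omega>. E \<omega> \<partial>M) \<le> 1"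

(* The library's indep_var requires both variables to have the same value type. *)
definition indep_rv ::
    "'w measure \<Rightarrow> 'a measure \<Rightarrow> ('w \<Rightarrow> 'a) \<Rightarrow> 'b measure \<Rightarrow> ('w \<Rightarrow> 'b) \<Rightarrow> bool" where
  "indep_rv M S U T V \<longleftrightarrow>
     U \<in> M \<rightarrow>\<^sub>M S \<and> V \<in> M \<rightarrow>\<^sub>M T \<and>
     prob_space.indep_set M
       {U -` A \<inter> space M |A. A \<in> sets S} {V -` B \<inter> space M |B. B \<in> sets T}"

definition p_adj :: "('x \<times> 'y \<times> 'z::finite) pmf \<Rightarrow> 'x \<Rightarrow> 'y \<Rightarrow> real" where
  "p_adj P x y =
     (\<Sum>z\<in>UNIV. \<P>((a, b, c) in measure_pmf P. c = z)
              * \<P>((a, b, c) in measure_pmf P. b = y \<bar> a = x \<and> c = z))"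

(* The sample is given by its coordinate sequences, of which only the entries 1..N are used. *)
definition F_est ::
    "nat \<Rightarrow> 'x \<Rightarrow> (nat \<Rightarrow> 'x) \<Rightarrow> (nat \<Rightarrow> 'y) \<Rightarrow> (nat \<Rightarrow> 'z::finite) \<Rightarrow> 'y \<Rightarrow> real" where
  "F_est N x xs ys zs y =
     (\<Sum>z\<in>UNIV.
        (real (card {n\<in>{1..N}. zs n = z}) + 1) / (real N + 1)
        * ((real (card {n\<in>{1..N}. (xs n, ys n, zs n) = (x, y, z)}) + 1)
           / (real (card {n\<in>{1..N}. (xs n, zs n) = (x, z)}) + 1)))"

end

theory Submission
  imports Defs
begin

text \<open>
  Since \<open>Y\<^sub>N\<^sub>+\<^sub>1\<close> is independent of the sample, the expectation of the quotient is
  \<open>\<Sum>\<^sub>y Q(y) p\<^sub>y E[1/F\<^sub>y]\<close>, so it is enough that \<open>p\<^sub>y E[1/F\<^sub>y] \<le> 1\<close> for each single \<open>y\<close>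
  (\<open>expectation_inverse_F_mset\<close>). Write \<open>p\<^sub>y = \<Sum>\<^sub>z c\<^sub>z\<close> and \<open>F\<^sub>y = \<Sum>\<^sub>z d\<^sub>z\<close> for the sums that define
  them. The map \<open>t \<mapsto> 1/t\<close> is convex, so \<open>p\<^sub>y\<^sup>2 / F\<^sub>y \<le> \<Sum>\<^sub>z c\<^sub>z\<^sup>2 / d\<^sub>z\<close>
  (\<open>sum_power2_div_sum_le\<close>), and the claim follows once \<open>c\<^sub>z / d\<^sub>z\<close> is known to be an e-variable
  for every \<open>z\<close>.

  The latter is a statement about three nested events \<open>S \<subseteq> T \<subseteq> U\<close>, namely \<open>(X,Y,Z) = (x,y,z)\<close>,
  \<open>(X,Z) = (x,z)\<close> and \<open>Z = z\<close>: the probability \<open>P(U) P(S) / P(T)\<close> is divided by its estimate, in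
  which every count of hits is increased by one (\<open>expectation_ratio_le\<close>). Adding one to the counts is
  what happens when one more observation is drawn and falls into the event in question. By
  exchangeability, the expectation over a sample of size \<open>n\<close> together with an extra observation in
  \<open>S\<close> is, up to the factor \<open>n + 1\<close>, an expectation over samples of size \<open>n + 1\<close> weighted by
  the number of hits of \<open>S\<close> (\<open>size_biasing\<close>). The weights cancel the denominators one after the
  other: the hits of \<open>S\<close> cancel those in \<open>1/(#S + 1)\<close> and leave the hits of \<open>T\<close> as the new
  weight; undoing the bias with respect to \<open>T\<close> leaves \<open>E[1/(#U + 1)]\<close>, and the same cancellation
  with \<open>U\<close> leaves the probability that a sample of size \<open>n + 1\<close> hits \<open>U\<close>.

  Everything depends on the sample only through the multiset of its values, whose law is that of
  \<open>mset\<close> under \<open>replicate_pmf\<close> (\<open>expectation_iid_mset\<close>).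
\<close>

section \<open>Size-biased samples\<close>

abbreviation hits :: "'a set \<Rightarrow> 'a multiset \<Rightarrow> nat" where
  "hits S D \<equiv> size {#w \<in># D. w \<in> S#}"

lemma expectation_replicate_pmf_Suc:
  fixes p :: "'a::finite pmf" and h :: "'a list \<Rightarrow> real"
  shows "measure_pmf.expectation (replicate_pmf (Suc n) p) h =
    (\<Sum>w\<in>UNIV. pmf p w * measure_pmf.expectation (replicate_pmf n p) (\<lambda>ws. h (w # ws)))"
proof -
  have fin: "finite (set_pmf (replicate_pmf n p))"
    by (rule finite_subset[OF _ finite_lists_length_eq[of UNIV n]]) (auto simp: set_replicate_pmf)
  show ?thesis
    by (simp add: pmf_expectation_bind[of UNIV] fin map_pmf_def[symmetric])
qed

lemma integrable_replicate_pmf: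
  fixes p :: "'a::finite pmf" and h :: "'a list \<Rightarrow> real"
  shows "integrable (measure_pmf (replicate_pmf n p)) h"
  by (intro integrable_measure_pmf_finite finite_subset[OF _ finite_lists_length_eq[of UNIV n]])
     (auto simp: set_replicate_pmf)

text \<open>
  In a sample of size \<open>n + 1\<close>, each of the hits of \<open>S\<close> can be singled out as the last draw; the
  \<open>n + 1\<close> positions are equally likely. The induction avoids permuting positions: the first draw \<open>v\<close>
  of the longer sample is either the hit that is singled out, or it is put into the test function,
  which is why \<open>G\<close> has to be arbitrary and to depend on the multiset only.
\<close>

lemma size_biasing:
  fixes p :: "'a::finite pmf" and G :: "'a multiset \<Rightarrow> real"
  shows "real (Suc n) * (\<Sum>w\<in>S. pmf p w *
           measure_pmf.expectation (replicate_pmf n p) (\<lambda>ws. G (add_mset w (mset ws))))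
       = measure_pmf.expectation (replicate_pmf (Suc n) p)
           (\<lambda>ws. real (hits S (mset ws)) * G (mset ws))"
proof (induction n arbitrary: G)
  case 0
  have "(\<Sum>w\<in>S. pmf p w * G {#w#}) = (\<Sum>w\<in>UNIV. if w \<in> S then pmf p w * G {#w#} else 0)"
    by (simp add: sum.If_cases)
  also have "\<dots> = (\<Sum>w\<in>UNIV. pmf p w * (real (hits S {#w#}) * G {#w#}))"
    by (intro sum.cong) auto
  finally show ?case
    by (simp add: expectation_replicate_pmf_Suc del: replicate_pmf.simps(2) cong: if_cong)
next
  case (Suc n)
  let ?E = "\<lambda>n. measure_pmf.expectation (replicate_pmf n p)"
  have split: "?E (Suc n) (\<lambda>ws. real (hits S (mset (v # ws))) * G (mset (v # ws)))
      = (if v \<in> S then ?E (Suc n) (\<lambda>ws. G (add_mset v (mset ws))) else 0)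
        + ?E (Suc n) (\<lambda>ws. real (hits S (mset ws)) * G (add_mset v (mset ws)))" for v
    by (auto simp: distrib_right Bochner_Integration.integral_add[OF integrable_replicate_pmf integrable_replicate_pmf]
             simp del: replicate_pmf.simps(2))
  have "?E (Suc (Suc n)) (\<lambda>ws. real (hits S (mset ws)) * G (mset ws))
      = (\<Sum>v\<in>UNIV. pmf p v * (if v \<in> S then ?E (Suc n) (\<lambda>ws. G (add_mset v (mset ws))) else 0))
      + (\<Sum>v\<in>UNIV. pmf p v * ?E (Suc n) (\<lambda>ws. real (hits S (mset ws)) * G (add_mset v (mset ws))))"
    by (subst expectation_replicate_pmf_Suc, subst split) (simp only: distrib_left sum.distrib)
  also have "(\<Sum>v\<in>UNIV. pmf p v * (if v \<in> S then ?E (Suc n) (\<lambda>ws. G (add_mset v (mset ws))) else 0))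
      = (\<Sum>v\<in>S. pmf p v * ?E (Suc n) (\<lambda>ws. G (add_mset v (mset ws))))"
    by (simp add: if_distrib[of "(*) _"] sum.If_cases del: replicate_pmf.simps(2) cong: if_cong)
  also have "(\<Sum>v\<in>UNIV. pmf p v * ?E (Suc n) (\<lambda>ws. real (hits S (mset ws)) * G (add_mset v (mset ws))))
      = (\<Sum>v\<in>UNIV. pmf p v * (real (Suc n) *
          (\<Sum>w\<in>S. pmf p w * ?E n (\<lambda>ws. G (add_mset v (add_mset w (mset ws)))))))"
    by (simp only: Suc.IH[of "\<lambda>D. G (add_mset _ D)", symmetric])
  also have "\<dots> = real (Suc n) * (\<Sum>w\<in>S. pmf p w *
          (\<Sum>v\<in>UNIV. pmf p v * ?E n (\<lambda>ws. G (add_mset w (add_mset v (mset ws))))))"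
    unfolding sum_distrib_left
    by (subst sum.swap) (simp add: ac_simps add_mset_commute)
  also have "\<dots> = real (Suc n) * (\<Sum>w\<in>S. pmf p w * ?E (Suc n) (\<lambda>ws. G (add_mset w (mset ws))))"
    by (simp only: expectation_replicate_pmf_Suc mset.simps)
  finally show ?case
    by (simp only: of_nat_Suc[of "Suc n"] distrib_right mult_1_left)
qed

text \<open>
  Size biasing produces quotients \<open>k / k\<close>, where \<open>k\<close> counts the hits in the enlarged sample of \<open>S\<close>
  and then of \<open>U\<close>. Bounding them by 1 is the only loss; it occurs where \<open>k = 0\<close>, since \<open>0 / 0 = 0\<close>.
\<close>

lemma expectation_ratio_le:
  fixes p :: "'a::finite pmf"
  assumes "S \<subseteq> T" "T \<subseteq> U"
  shows "measure p S * measure p U *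
     measure_pmf.expectation (replicate_pmf n p) (\<lambda>ws. (real n + 1) / (real (hits U (mset ws)) + 1) *
        ((real (hits T (mset ws)) + 1) / (real (hits S (mset ws)) + 1))) \<le> measure p T"
proof -
  let ?E = "\<lambda>n. measure_pmf.expectation (replicate_pmf n p)"
  have biased: "real (Suc n) * (measure p V * ?E n f)
      = ?E (Suc n) (\<lambda>ws. real (hits V (mset ws)) * G (mset ws))"
    if "\<And>w ws. w \<in> V \<Longrightarrow> G (add_mset w (mset ws)) = f ws" for V G f
  proof -
    have "measure p V * ?E n f = (\<Sum>w\<in>V. pmf p w * ?E n (\<lambda>ws. G (add_mset w (mset ws))))"
      by (simp add: measure_measure_pmf_finite sum_distrib_right that)
    then show ?thesis by (simp only: size_biasing)
  qed
  have mono: "?E m f \<le> ?E m g" if "\<And>ws. f ws \<le> g ws" for m and f g :: "'a list \<Rightarrow> real"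
    by (intro integral_mono integrable_replicate_pmf that)
  (* The factor n + 1 is kept out of a: it is the one that size biasing by U uses up. *)
  define a where "a = ?E n (\<lambda>ws. (real (hits T (mset ws)) + 1) /
        ((real (hits S (mset ws)) + 1) * (real (hits U (mset ws)) + 1)))"
  define b where "b = ?E n (\<lambda>ws. 1 / (real (hits U (mset ws)) + 1))"
  have "real (Suc n) * (measure p S * a)
     = ?E (Suc n) (\<lambda>ws. real (hits S (mset ws)) * (real (hits T (mset ws)) /
          (real (hits S (mset ws)) * real (hits U (mset ws)))))"
    unfolding a_def using assms
    by (intro biased[of S "\<lambda>D. real (hits T D) / (real (hits S D) * real (hits U D))"])
       (auto simp: add.commute)
  also have "\<dots> \<le> ?E (Suc n) (\<lambda>ws. real (hits T (mset ws)) * (1 / real (hits U (mset ws))))"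
    by (intro mono) (auto simp: field_simps)
  also have "\<dots> = real (Suc n) * (measure p T * b)"
    unfolding b_def using assms
    by (intro biased[of T "\<lambda>D. 1 / real (hits U D)", symmetric]) (auto simp: add.commute)
  finally have 1: "measure p S * a \<le> measure p T * b"
    by (simp del: of_nat_Suc)
  have "real (Suc n) * (measure p U * b) =
     ?E (Suc n) (\<lambda>ws. real (hits U (mset ws)) * (1 / real (hits U (mset ws))))"
    unfolding b_def
    by (intro biased[of U "\<lambda>D. 1 / real (hits U D)"]) (auto simp: add.commute)
  also have "\<dots> \<le> ?E (Suc n) (\<lambda>_. 1)"
    by (intro mono) auto
  finally have 2: "real (Suc n) * (measure p U * b) \<le> 1" by simp
  have "measure p S * measure p U * (real (Suc n) * a) = real (Suc n) * measure p U * (measure p S * a)"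
    by simp
  also have "\<dots> \<le> real (Suc n) * measure p U * (measure p T * b)"
    using 1 by (intro mult_left_mono) auto
  also have "\<dots> = measure p T * (real (Suc n) * (measure p U * b))" by simp
  also have "\<dots> \<le> measure p T * 1"
    using 2 by (intro mult_left_mono) auto
  also have "real (Suc n) * a = ?E n (\<lambda>ws. (real n + 1) / (real (hits U (mset ws)) + 1) *
        ((real (hits T (mset ws)) + 1) / (real (hits S (mset ws)) + 1)))"
    unfolding a_def by (subst integral_mult_right_zero[symmetric]) (simp add: add.commute mult.commute)
  finally show ?thesis by simp
qed

section \<open>Convexity of the reciprocal\<close>

text \<open>
  For positive \<open>c\<close> this is Jensen's inequality for \<open>t \<mapsto> 1/t\<close> at the points \<open>d\<^sub>i / c\<^sub>i\<close> with weights
  proportional to \<open>c\<^sub>i\<close>. For every \<open>c\<close> it is the Cauchy-Schwarz inequality for the vectors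
  \<open>c\<^sub>i / sqrt d\<^sub>i\<close> and \<open>sqrt d\<^sub>i\<close>.
\<close>

lemma sum_power2_div_sum_le:
  fixes c d :: "'i \<Rightarrow> real"
  assumes "finite I" "I \<noteq> {}" and pos: "\<And>i. i \<in> I \<Longrightarrow> 0 < d i"
  shows "(\<Sum>i\<in>I. c i)\<^sup>2 / (\<Sum>i\<in>I. d i) \<le> (\<Sum>i\<in>I. (c i)\<^sup>2 / d i)"
proof -
  have nz: "d i \<noteq> 0" if "i \<in> I" for i
    using pos[OF that] by simp
  have "(\<Sum>i\<in>I. c i)\<^sup>2 = (\<Sum>i\<in>I. c i / sqrt (d i) * sqrt (d i))\<^sup>2"
    by (simp add: nz)
  also have "\<dots> \<le> (\<Sum>i\<in>I. (c i / sqrt (d i))\<^sup>2) * (\<Sum>i\<in>I. (sqrt (d i))\<^sup>2)"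
    by (rule Cauchy_Schwarz_ineq_sum)
  also have "\<dots> = (\<Sum>i\<in>I. (c i)\<^sup>2 / d i) * (\<Sum>i\<in>I. d i)"
    using pos by (simp add: power_divide less_imp_le)
  finally show ?thesis
    using assms by (simp add: divide_le_eq sum_pos)
qed

section \<open>From random variables to the law of the sample multiset\<close>

context prob_space
begin

lemma expectation_finite_valued:
  fixes f :: "'u \<Rightarrow> real"
  assumes U: "U \<in> M \<rightarrow>\<^sub>M count_space K" and K: "finite K"
  shows "integrable M (\<lambda>\<omega>. f (U \<omega>))"
    and "expectation (\<lambda>\<omega>. f (U \<omega>)) = (\<Sum>u\<in>K. f u * prob (U -` {u} \<inter> space M))"
proof -
  have [measurable]: "U -` {u} \<inter> space M \<in> events" if "u \<in> K" for u
    using U that by (intro measurable_sets) auto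
  have step: "f (U \<omega>) = (\<Sum>u\<in>K. f u * indicator (U -` {u} \<inter> space M) \<omega>)" if "\<omega> \<in> space M" for \<omega>
  proof -
    have "U \<omega> \<in> K" using measurable_space[OF U that] by simp
    then show ?thesis
      using that K by (simp add: indicator_def if_distrib[of "(*) _"] eq_commute cong: if_cong)
  qed
  have int: "integrable M (\<lambda>\<omega>. \<Sum>u\<in>K. f u * indicator (U -` {u} \<inter> space M) \<omega> :: real)"
    by (intro Bochner_Integration.integrable_sum integrable_mult_right integrable_real_indicator)
       (auto simp: emeasure_eq_measure)
  then show "integrable M (\<lambda>\<omega>. f (U \<omega>))"
    by (subst Bochner_Integration.integrable_cong[OF refl step])
  have "expectation (\<lambda>\<omega>. f (U \<omega>)) = expectation (\<lambda>\<omega>. \<Sum>u\<in>K. f u * indicator (U -` {u} \<inter> space M) \<omega>)"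
    by (intro Bochner_Integration.integral_cong refl step)
  also have "\<dots> = (\<Sum>u\<in>K. f u * prob (U -` {u} \<inter> space M))"
    by (subst Bochner_Integration.integral_sum)
       (auto simp: emeasure_eq_measure intro!: integrable_mult_right integrable_real_indicator sum.cong
          arg_cong2[where f = "(*)"] arg_cong[where f = prob])
  finally show "expectation (\<lambda>\<omega>. f (U \<omega>)) = \<dots>" .
qed

lemma expectation_indep_rv:
  fixes f :: "'u \<Rightarrow> 'v::finite \<Rightarrow> real"
  assumes ind: "indep_rv M (count_space K) U (count_space UNIV) V" and K: "finite K"
  shows "integrable M (\<lambda>\<omega>. f (U \<omega>) (V \<omega>))"
    and "expectation (\<lambda>\<omega>. f (U \<omega>) (V \<omega>))
       = (\<Sum>v\<in>UNIV. prob (V -` {v} \<inter> space M) * expectation (\<lambda>\<omega>. f (U \<omega>) v))"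
proof -
  have U: "U \<in> M \<rightarrow>\<^sub>M count_space K" and V: "V \<in> M \<rightarrow>\<^sub>M count_space UNIV"
    and ind_set: "indep_set {U -` A \<inter> space M |A. A \<in> sets (count_space K)}
                   {V -` B \<inter> space M |B. B \<in> sets (count_space UNIV)}"
    using ind by (simp_all only: indep_rv_def)
  have "(\<lambda>\<omega>. (U \<omega>, V \<omega>)) \<in> M \<rightarrow>\<^sub>M count_space K \<Otimes>\<^sub>M count_space UNIV"
    using U V by (rule measurable_Pair)
  also have "count_space K \<Otimes>\<^sub>M count_space UNIV = (count_space (K \<times> UNIV) :: ('u \<times> 'v) measure)"
    using K by (intro pair_measure_count_space) auto
  finally have UV: "(\<lambda>\<omega>. (U \<omega>, V \<omega>)) \<in> M \<rightarrow>\<^sub>M count_space (K \<times> UNIV)" .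
  have fin: "finite (K \<times> (UNIV :: 'v set))" using K by simp
  note E = expectation_finite_valued[OF UV fin, of "\<lambda>(u, v). f u v"]
  show "integrable M (\<lambda>\<omega>. f (U \<omega>) (V \<omega>))"
    using E(1) by simp
  have "prob ((\<lambda>\<omega>. (U \<omega>, V \<omega>)) -` {(u, v)} \<inter> space M)
      = prob (U -` {u} \<inter> space M) * prob (V -` {v} \<inter> space M)" if "u \<in> K" for u v
  proof -
    have "(\<lambda>\<omega>. (U \<omega>, V \<omega>)) -` {(u, v)} \<inter> space M = (U -` {u} \<inter> space M) \<inter> (V -` {v} \<inter> space M)"
      by auto
    moreover have "prob ((U -` {u} \<inter> space M) \<inter> (V -` {v} \<inter> space M))
        = prob (U -` {u} \<inter> space M) * prob (V -` {v} \<inter> space M)"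
      using that by (intro indep_setD[OF ind_set]) auto
    ultimately show ?thesis by simp
  qed
  then have "expectation (\<lambda>\<omega>. f (U \<omega>) (V \<omega>))
     = (\<Sum>u\<in>K. \<Sum>v\<in>UNIV. f u v * (prob (U -` {u} \<inter> space M) * prob (V -` {v} \<inter> space M)))"
    using E(2) by (subst sum.cartesian_product) (auto intro!: sum.cong)
  also have "\<dots> = (\<Sum>v\<in>UNIV. prob (V -` {v} \<inter> space M) * (\<Sum>u\<in>K. f u v * prob (U -` {u} \<inter> space M)))"
    by (subst sum.swap) (simp add: sum_distrib_left ac_simps)
  finally show "expectation (\<lambda>\<omega>. f (U \<omega>) (V \<omega>))
       = (\<Sum>v\<in>UNIV. prob (V -` {v} \<inter> space M) * expectation (\<lambda>\<omega>. f (U \<omega>) v))"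
    by (simp add: expectation_finite_valued(2)[OF U K, of "\<lambda>u. f u v" for v])
qed

text \<open>
  Disjoint blocks of an independent family are independent. The coordinate \<open>i\<close> generates the same
  events as the block \<open>{i}\<close>, whose values have the same type as those of the block \<open>A\<close>, as
  \<open>indep_var\<close> requires.
\<close>

lemma indep_vars_imp_indep_rv:
  assumes ind: "indep_vars M' W I" and "A \<subseteq> I" "i \<in> I" "i \<notin> A"
  shows "indep_rv M (PiM A M') (\<lambda>\<omega>. \<lambda>j\<in>A. W j \<omega>) (M' i) (W i)"
proof -
  have ind': "indep_var (PiM A M') (\<lambda>\<omega>. \<lambda>j\<in>A. W j \<omega>) (PiM {i} M') (\<lambda>\<omega>. \<lambda>j\<in>{i}. W j \<omega>)"
    using assms by (intro indep_var_restrict[OF ind]) auto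
  have U: "(\<lambda>\<omega>. \<lambda>j\<in>A. W j \<omega>) \<in> M \<rightarrow>\<^sub>M PiM A M'"
    by (rule indep_var_rv1[OF ind'])
  have W: "W i \<in> M \<rightarrow>\<^sub>M M' i"
    using assms by (auto simp: indep_vars_def)
  have "prob (((\<lambda>\<omega>. \<lambda>j\<in>A. W j \<omega>) -` B \<inter> space M) \<inter> (W i -` C \<inter> space M))
      = prob ((\<lambda>\<omega>. \<lambda>j\<in>A. W j \<omega>) -` B \<inter> space M) * prob (W i -` C \<inter> space M)"
    if "B \<in> sets (PiM A M')" "C \<in> sets (M' i)" for B C
  proof -
    let ?C = "(\<lambda>g. g i) -` C \<inter> space (PiM {i} M')"
    have C: "?C \<in> sets (PiM {i} M')"
      using that by (intro measurable_sets[OF measurable_component_singleton]) auto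
    have vimage_W: "(\<lambda>\<omega>. \<lambda>j\<in>{i}. W j \<omega>) -` ?C \<inter> space M = W i -` C \<inter> space M"
      using measurable_space[OF W] by (auto simp: space_PiM)
    have vimage_Pair: "(\<lambda>\<omega>. (\<lambda>j\<in>A. W j \<omega>, \<lambda>j\<in>{i}. W j \<omega>)) -` (B \<times> ?C) \<inter> space M
      = ((\<lambda>\<omega>. \<lambda>j\<in>A. W j \<omega>) -` B \<inter> space M) \<inter> ((\<lambda>\<omega>. \<lambda>j\<in>{i}. W j \<omega>) -` ?C \<inter> space M)"
      by blast
    show ?thesis
      using indep_varD[OF ind' that(1) C] unfolding vimage_Pair vimage_W .
  qed
  then show ?thesis
    using U W unfolding indep_rv_def indep_sets2_eq
    by (auto intro: measurable_sets)
qed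

lemma expectation_iid_mset:
  fixes W :: "nat \<Rightarrow> 'a \<Rightarrow> 'b::finite" and G :: "'b multiset \<Rightarrow> real"
  assumes ind: "indep_vars (\<lambda>_. count_space UNIV) W {1..N}"
    and distr: "\<And>n. n \<in> {1..N} \<Longrightarrow> distr M (count_space UNIV) (W n) = measure_pmf p"
    and "n \<le> N"
  shows "expectation (\<lambda>\<omega>. G (image_mset (\<lambda>i. W i \<omega>) (mset_set {1..n})))
       = measure_pmf.expectation (replicate_pmf n p) (\<lambda>ws. G (mset ws))"
  using \<open>n \<le> N\<close>
proof (induction n arbitrary: G)
  case 0
  then show ?case by (simp add: prob_space)
next
  case (Suc n)
  (* On a finite index set the product of finite discrete spaces is discrete,
     so that every function of the block of observations is measurable. *)
  let ?K = "PiE {1..n} (\<lambda>_. UNIV :: 'b set)"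
  have K: "finite ?K" by (intro finite_PiE) auto
  have indep: "indep_rv M (count_space ?K) (\<lambda>\<omega>. \<lambda>i\<in>{1..n}. W i \<omega>) (count_space UNIV) (W (Suc n))"
    using indep_vars_imp_indep_rv[OF ind, of "{1..n}" "Suc n"] Suc.prems
    by (simp add: count_space_PiM_finite)
  have law: "prob (W (Suc n) -` {w} \<inter> space M) = pmf p w" for w
  proof -
    have "W (Suc n) \<in> M \<rightarrow>\<^sub>M count_space UNIV"
      using ind Suc.prems by (auto simp: indep_vars_def)
    then show ?thesis
      using measure_distr[of "W (Suc n)" M "count_space UNIV" "{w}"] distr[of "Suc n"] Suc.prems
      by (simp add: measure_pmf_single)
  qed
  let ?D = "\<lambda>g. image_mset g (mset_set {1..n})"
  have restrict: "?D (\<lambda>i\<in>{1..n}. g i) = ?D g" for g :: "nat \<Rightarrow> 'b"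
    by (intro image_mset_cong) simp
  have "mset_set {1..Suc n} = add_mset (Suc n) (mset_set {1..n})"
    by (simp add: atLeastAtMostSuc_conv)
  then have "expectation (\<lambda>\<omega>. G (image_mset (\<lambda>i. W i \<omega>) (mset_set {1..Suc n})))
     = expectation (\<lambda>\<omega>. G (add_mset (W (Suc n) \<omega>) (?D (\<lambda>i\<in>{1..n}. W i \<omega>))))"
    by (simp only: restrict image_mset_add_mset)
  also have "\<dots> = (\<Sum>w\<in>UNIV. pmf p w * expectation (\<lambda>\<omega>. G (add_mset w (?D (\<lambda>i. W i \<omega>)))))"
    by (subst expectation_indep_rv(2)[OF indep K, where f = "\<lambda>g w. G (add_mset w (?D g))"])
       (simp only: law restrict)
  also have "\<dots> = (\<Sum>w\<in>UNIV. pmf p w *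
       measure_pmf.expectation (replicate_pmf n p) (\<lambda>ws. G (add_mset w (mset ws))))"
    using Suc.prems by (intro sum.cong refl arg_cong2[where f = "(*)"]
      Suc.IH[of "\<lambda>D. G (add_mset w D)" for w]) simp
  finally show ?case
    by (simp only: expectation_replicate_pmf_Suc mset.simps)
qed

end


section \<open>The estimator as a function of the sample multiset\<close>

definition F_mset :: "nat \<Rightarrow> 'x \<Rightarrow> 'y \<Rightarrow> ('x \<times> 'y \<times> 'z::finite) multiset \<Rightarrow> real" where
  "F_mset N x y D = (\<Sum>z\<in>UNIV.
     (real (hits {(a, b, c). c = z} D) + 1) / (real N + 1) *
     ((real (hits {(x, y, z)} D) + 1) / (real (hits {(a, b, c). a = x \<and> c = z} D) + 1)))"

lemma F_est_eq_F_mset: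
  "F_est N x (\<lambda>n. fst (W n)) (\<lambda>n. fst (snd (W n))) (\<lambda>n. snd (snd (W n))) y
     = F_mset N x y (image_mset W (mset_set {1..N}))"
proof -
  have "hits S (image_mset W (mset_set {1..N})) = card {n \<in> {1..N}. W n \<in> S}" for S
    by (simp add: filter_mset_image_mset[symmetric] image_mset_filter_mset_swap[symmetric])
  then show ?thesis
    unfolding F_est_def F_mset_def
    by (simp only:) (simp add: case_prod_unfold prod_eq_iff)
qed

lemma F_mset_pos: "F_mset N x y D > 0"
  unfolding F_mset_def by (intro sum_pos mult_pos_pos divide_pos_pos) auto

text \<open>
  The inequality is proved after multiplication by \<open>p_adj P x y\<close>. In the Cauchy-Schwarz bound the
  weights \<open>c z\<close> then occur squared: one factor makes \<open>c z / d D z\<close> an e-variable, and the other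
  one remains and sums up to \<open>p_adj P x y\<close>.
\<close>

lemma expectation_inverse_F_mset:
  fixes P :: "('x::finite \<times> 'y::finite \<times> 'z::finite) pmf"
  assumes P_pos: "\<And>a b c. pmf P (a, b, c) > 0"
  shows "p_adj P x y * measure_pmf.expectation (replicate_pmf N P) (\<lambda>ws. 1 / F_mset N x y (mset ws)) \<le> 1"
proof -
  let ?E = "measure_pmf.expectation (replicate_pmf N P)"
  define U where "U z = {(a :: 'x, b :: 'y, c :: 'z). c = z}" for z
  define T where "T z = {(a, b :: 'y, c :: 'z). a = x \<and> c = z}" for z
  define S where "S z = {(x, y, z :: 'z)}" for z
  define c where "c z = measure P (U z) * (measure P (S z) / measure P (T z))" for z
  define d where "d D z = (real (hits (U z) D) + 1) / (real N + 1) *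
     ((real (hits (S z) D) + 1) / (real (hits (T z) D) + 1))" for D z
  have pos: "measure P A > 0" if "(x, y, z) \<in> A" for z A
  proof -
    have "0 < pmf P (x, y, z)" by (rule P_pos)
    also have "\<dots> \<le> measure P A"
      using that by (simp add: measure_pmf_single[symmetric] measure_pmf.finite_measure_mono)
    finally show ?thesis .
  qed
  have mem: "(x, y, z) \<in> S z" "(x, y, z) \<in> T z" "(x, y, z) \<in> U z" for z
    by (auto simp: S_def T_def U_def)
  have c_pos: "c z > 0" for z
    unfolding c_def using pos mem by (intro mult_pos_pos divide_pos_pos) blast+
  have d_pos: "d D z > 0" for D z
    unfolding d_def by (intro mult_pos_pos divide_pos_pos) auto
  have p: "p_adj P x y = (\<Sum>z\<in>UNIV. c z)"
    unfolding p_adj_def cond_prob_def c_def U_def T_def S_def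
    by (intro sum.cong refl arg_cong2[where f = "(*)"] arg_cong2[where f = "(/)"] arg_cong2[where f = measure]) auto
  then have p_pos: "p_adj P x y > 0"
    using c_pos by (simp add: sum_pos)
  have F: "F_mset N x y D = (\<Sum>z\<in>UNIV. d D z)" for D
    by (simp add: F_mset_def d_def U_def T_def S_def)
  have weighted: "(c z)\<^sup>2 * ?E (\<lambda>ws. 1 / d (mset ws) z) \<le> c z" for z
  proof -
    have "measure P (S z) * measure P (U z) * ?E (\<lambda>ws. 1 / d (mset ws) z) \<le> measure P (T z)"
      using expectation_ratio_le[of "S z" "T z" "U z" P N]
      by (auto simp: d_def S_def T_def U_def)
    then have "c z * ?E (\<lambda>ws. 1 / d (mset ws) z) \<le> 1"
      using pos[OF mem(2)[of z]] by (simp add: c_def field_simps)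
    then show ?thesis
      using mult_left_mono[of _ 1 "c z"] c_pos[of z] by (simp add: power2_eq_square mult.assoc)
  qed
  have "p_adj P x y * (p_adj P x y * ?E (\<lambda>ws. 1 / F_mset N x y (mset ws)))
      = ?E (\<lambda>ws. (\<Sum>z\<in>UNIV. c z)\<^sup>2 / (\<Sum>z\<in>UNIV. d (mset ws) z))"
    by (simp add: p F power2_eq_square divide_inverse mult.assoc)
  also have "\<dots> \<le> ?E (\<lambda>ws. \<Sum>z\<in>UNIV. (c z)\<^sup>2 * (1 / d (mset ws) z))"
    using sum_power2_div_sum_le[of "UNIV :: 'z set" "d _" c] d_pos
    by (intro integral_mono integrable_replicate_pmf) simp
  also have "\<dots> = (\<Sum>z\<in>UNIV. (c z)\<^sup>2 * ?E (\<lambda>ws. 1 / d (mset ws) z))"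
    by (simp only: Bochner_Integration.integral_sum[OF integrable_replicate_pmf] integral_mult_right_zero)
  also have "\<dots> \<le> p_adj P x y * 1"
    unfolding p by (simp add: sum_mono weighted)
  finally show ?thesis
    using p_pos by (simp del: mult_1_right)
qed

section \<open>The e-variable\<close>

theorem corollary2:
  fixes P :: "('x::finite \<times> 'y::finite \<times> 'z::finite) pmf"
    and Q :: "'y pmf"
    and x :: 'x
    and N :: nat
    and M :: "'w measure"
    and X :: "nat \<Rightarrow> 'w \<Rightarrow> 'x"
    and Y :: "nat \<Rightarrow> 'w \<Rightarrow> 'y"
    and Z :: "nat \<Rightarrow> 'w \<Rightarrow> 'z"
  assumes P_pos: "\<And>a b c. pmf P (a, b, c) > 0"
    and N_pos: "N \<ge> 1"
    and M: "prob_space M"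
    and sample_indep:
      "prob_space.indep_vars M (\<lambda>_. count_space UNIV) (\<lambda>n \<omega>. (X n \<omega>, Y n \<omega>, Z n \<omega>)) {1..N}"
    and sample_distr:
      "\<And>n. n \<in> {1..N} \<Longrightarrow>
         distr M (count_space UNIV) (\<lambda>\<omega>. (X n \<omega>, Y n \<omega>, Z n \<omega>)) = measure_pmf P"
    and Y_new_indep:
      "indep_rv M
         (PiM {1..N} (\<lambda>_. count_space UNIV)) (\<lambda>\<omega>. \<lambda>n\<in>{1..N}. (X n \<omega>, Y n \<omega>, Z n \<omega>))
         (count_space UNIV) (Y (N + 1))"
    and Y_new_distr:
      "\<And>y. \<P>(\<omega> in M. Y (N + 1) \<omega> = y) = p_adj P x y"
  shows "e_variable M
    (\<lambda>\<omega>. measure (measure_pmf Q) {Y (N + 1) \<omega>}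
        / F_est N x (\<lambda>n. X n \<omega>) (\<lambda>n. Y n \<omega>) (\<lambda>n. Z n \<omega>) (Y (N + 1) \<omega>))"
proof -
  interpret prob_space M by (rule M)
  let ?K = "PiE {1..N} (\<lambda>_. UNIV :: ('x \<times> 'y \<times> 'z) set)"
  define W where "W n \<omega> = (X n \<omega>, Y n \<omega>, Z n \<omega>)" for n \<omega>
  define E where "E D y = pmf Q y * (1 / F_mset N x y D)" for D :: "('x \<times> 'y \<times> 'z) multiset" and y
  have K: "finite ?K" by (intro finite_PiE) auto
  have indep: "indep_rv M (count_space ?K) (\<lambda>\<omega>. \<lambda>n\<in>{1..N}. W n \<omega>) (count_space UNIV) (Y (N + 1))"
    using Y_new_indep by (simp add: count_space_PiM_finite W_def)
  have restrict: "image_mset (\<lambda>n\<in>{1..N}. g n) (mset_set {1..N}) = image_mset g (mset_set {1..N})"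
    for g :: "nat \<Rightarrow> 'x \<times> 'y \<times> 'z"
    by (intro image_mset_cong) simp
  have E_eq: "measure (measure_pmf Q) {Y (N + 1) \<omega>}
        / F_est N x (\<lambda>n. X n \<omega>) (\<lambda>n. Y n \<omega>) (\<lambda>n. Z n \<omega>) (Y (N + 1) \<omega>)
      = E (image_mset (\<lambda>n\<in>{1..N}. W n \<omega>) (mset_set {1..N})) (Y (N + 1) \<omega>)" for \<omega>
    using F_est_eq_F_mset[of N x "\<lambda>n. W n \<omega>" "Y (N + 1) \<omega>"]
    by (simp only: restrict) (simp add: E_def W_def measure_pmf_single)
  note split = expectation_indep_rv[OF indep K,
      where f = "\<lambda>g. E (image_mset g (mset_set {1..N}))"]
  have "expectation (\<lambda>\<omega>. E (image_mset (\<lambda>n\<in>{1..N}. W n \<omega>) (mset_set {1..N})) (Y (N + 1) \<omega>))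
      = (\<Sum>y\<in>UNIV. p_adj P x y *
          expectation (\<lambda>\<omega>. E (image_mset (\<lambda>n. W n \<omega>) (mset_set {1..N})) y))"
    using Y_new_distr
    by (subst split(2)) (simp only: restrict, simp add: vimage_def Int_def conj_commute)
  also have "\<dots> = (\<Sum>y\<in>UNIV. p_adj P x y *
          measure_pmf.expectation (replicate_pmf N P) (\<lambda>ws. E (mset ws) y))"
    using sample_indep sample_distr
    by (intro sum.cong refl arg_cong2[where f = "(*)"]
          expectation_iid_mset[where N = N and G = "\<lambda>D. E D y" for y])
       (auto simp: W_def[abs_def])
  also have "\<dots> = (\<Sum>y\<in>UNIV. pmf Q y * (p_adj P x y *
          measure_pmf.expectation (replicate_pmf N P) (\<lambda>ws. 1 / F_mset N x y (mset ws))))"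
    unfolding E_def integral_mult_right_zero by (simp only: ac_simps)
  also have "\<dots> \<le> (\<Sum>y\<in>UNIV. pmf Q y * 1)"
    by (intro sum_mono mult_left_mono expectation_inverse_F_mset P_pos) auto
  also have "\<dots> = 1"
    by (simp add: sum_pmf_eq_1)
  finally show ?thesis
    unfolding e_variable_def E_eq
    using split(1) by (auto simp: E_def less_imp_le[OF F_mset_pos])
qed

end
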